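(* Let $F:[1,\infty)\to\mathbb{R}$ be a non-decreasing, right-continuous function with $F(1)=0$, $F(x)\to\infty$ as $x\to\infty$, and satisfying the Chebyshev upper bound $F(x)\ll x/\log x$ (for large $x$). Then there exists a set of generalized primes $\mathcal{P}=\{p_j\}_{j}$ such that $|\pi_{\mathcal{P}}(x)-F(x)|\le 2$ for all $x\ge 1$, and such that for all real $t$ and all $x\ge 1$ \[ \Bigl|\sum_{p_j\le x}p_j^{-\mathrm{i}t}-\int_1^x u^{-\mathrm{i}t}\,\mathrm{d}F(u)\Bigr|\ll \sqrt{x}+\sqrt{\frac{x\log(|t|+1)}{\log(x+1)}}, \] where the implied constant is independent of $x$ and $t$. If in addition $F$ is continuous, then $\mathcal{P}$ can be chosen to be strictly increasing and such that $|\pi_{\mathcal{P}}(x)-F(x)|\le 1$ for all $x\ge1$. *)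

theory Defs
  imports "HOL-Analysis.Analysis" "HOL-Library.Landau_Symbols"
begin

definition gen_primes :: "(nat \<Rightarrow> real) \<Rightarrow> bool" where
  "gen_primes p \<longleftrightarrow> p 0 > 1 \<and> mono p \<and> filterlim p at_top sequentially"

definition gpi :: "(nat \<Rightarrow> real) \<Rightarrow> real \<Rightarrow> nat" where
  "gpi p x = card {j. p j \<le> x}"

definition Fext :: "(real \<Rightarrow> real) \<Rightarrow> real \<Rightarrow> real" where
  "Fext F u = F (max u 1)"

text \<open>Riemann--Stieltjes integral \<open>\<integral>_1^x g(u) dF(u)\<close>, taken as the Lebesgue--Stieltjes
  integral over (1,x] w.r.t. the measure induced by the extended F.\<close>
definition stieltjes_int :: "(real \<Rightarrow> real) \<Rightarrow> (real \<Rightarrow> complex) \<Rightarrow> real \<Rightarrow> complex" where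
  "stieltjes_int F g x = set_lebesgue_integral (interval_measure (Fext F)) {1<..x} g"

end

theory Submission
  imports Defs "HOL-Probability.Probability" "HOL-Library.Nat_Bijection"
begin

text \<open>Let \<open>G\<close> be the lower inverse (\<open>quantile\<close>) of \<open>F\<close>; it carries Lebesgue measure on
  \<open>(0, F(x)]\<close> to \<open>dF\<close> on \<open>(1, x]\<close>. Put \<open>p\<^sub>j = G(s\<^sub>j)\<close> with \<open>s\<^sub>j \<in> (j, j+1]\<close>. Since
  \<open>p\<^sub>j \<le> x \<longleftrightarrow> s\<^sub>j \<le> F(x)\<close>, the counting function is always within 1 of \<open>F\<close>.
  The \<open>s\<^sub>j\<close> are not chosen at random but by the method of conditional expectations: for countably
  many bounded test functions \<open>f\<^sub>i\<close> with parameters \<open>l\<^sub>i\<close> and summable weights \<open>w\<^sub>i\<close>, Hoeffding's lemma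
  says that averaging over \<open>s\<^sub>J\<close> does not increase the potential
  \<open>\<Sum>i. w\<^sub>i exp (l\<^sub>i \<Sum>j<J. (f\<^sub>i(s\<^sub>j) - E f\<^sub>i) - J l\<^sub>i\<^sup>2 / 2)\<close>, so some choice of \<open>s\<^sub>J\<close> does not increase it either.
  Every term is then bounded for all \<open>J\<close> simultaneously. The test functions are the real parts of
  the four rotations of \<open>u\<^bsup>i\<tau>\<^esup>\<close> for rational \<open>\<tau> = m / N\<close>; a given pair \<open>(x, t)\<close> is
  handled by \<open>N = \<lceil>x\<rceil>\<close> and \<open>m = \<lfloor>-tN\<rfloor>\<close>, with \<open>l\<^sub>i\<close> tuned to \<open>J = O(N / log N)\<close>.\<close>

section \<open>Derandomised Hoeffding bound\<close>

text \<open>Hoeffding's lemma for a variable with values in [-1, 1]: the range has length 2, so the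
  exponent l^2 * 2^2 / 8 becomes l^2 / 2.\<close>

lemma nn_integral_exp_centered_le:
  fixes f :: "'a \<Rightarrow> real"
  assumes "prob_space M" and [measurable]: "f \<in> borel_measurable M"
    and bd: "\<And>x. x \<in> space M \<Longrightarrow> \<bar>f x\<bar> \<le> 1" and "l > 0"
  shows "(\<integral>\<^sup>+x. ennreal (exp (l * (f x - (LINT y|M. f y)))) \<partial>M) \<le> ennreal (exp (l\<^sup>2 / 2))"
proof -
  interpret prob_space M by fact
  interpret interval_bounded_random_variable M f "-1" 1
    using bd by unfold_locales (auto intro!: AE_I2 simp: abs_le_iff minus_le_iff)
  show ?thesis
    using Hoeffdings_lemma_nn_integral[OF \<open>l > 0\<close>] by simp
qed

text \<open>If every point pushed the potential above \<open>W\<close>, so would its mean; but by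
  Hoeffding the mean of the i-th term is at most \<open>a i\<close>. Working in
  \<open>ennreal\<close> lets sum and integral be exchanged without any summability
  condition.\<close>

lemma hoeffding_potential_step:
  fixes f :: "nat \<Rightarrow> 'a \<Rightarrow> real" and a l :: "nat \<Rightarrow> real"
  assumes "prob_space M" and [measurable]: "\<And>i. f i \<in> borel_measurable M"
    and bd: "\<And>i x. x \<in> space M \<Longrightarrow> \<bar>f i x\<bar> \<le> 1"
    and l: "\<And>i. l i > 0" and a: "\<And>i. a i \<ge> 0"
    and W: "(\<Sum>i. ennreal (a i)) \<le> ennreal W"
  shows "\<exists>x\<in>space M. (\<Sum>i. ennreal (a i * exp (l i * (f i x - (LINT y|M. f i y)) - (l i)\<^sup>2 / 2))) \<le> ennreal W"
proof (rule ccontr)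
  interpret prob_space M by fact
  define g where "g x = (\<Sum>i. ennreal (a i * exp (l i * (f i x - (LINT y|M. f i y)) - (l i)\<^sup>2 / 2)))" for x
  assume "\<not> ?thesis"
  then have gt: "ennreal W < g x" if "x \<in> space M" for x
    using that by (auto simp: g_def not_le)
  have [measurable]: "g \<in> borel_measurable M"
    unfolding g_def by measurable
  have "(\<integral>\<^sup>+x. ennreal W \<partial>M) < (\<integral>\<^sup>+x. g x \<partial>M)"
  proof (rule nn_integral_less)
    \<comment> \<open>Strictness survives integration because the set where \<open>g\<close> exceeds
      \<open>W\<close> is the whole space, which has mass 1.\<close>
    show "\<not> (AE x in M. g x \<le> ennreal W)"
    proof
      assume "AE x in M. g x \<le> ennreal W"
      with AE_space have "AE x in M. False"
        by eventually_elim (use gt in \<open>force simp: not_le[symmetric]\<close>)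
      then show False by simp
    qed
    show "AE x in M. ennreal W \<le> g x"
      by (rule AE_I2) (use gt in \<open>simp add: less_imp_le\<close>)
  qed (simp_all add: emeasure_space_1)
  also have "(\<integral>\<^sup>+x. g x \<partial>M) =
      (\<Sum>i. \<integral>\<^sup>+x. ennreal (a i * exp (l i * (f i x - (LINT y|M. f i y)) - (l i)\<^sup>2 / 2)) \<partial>M)"
    unfolding g_def by (rule nn_integral_suminf) measurable
  also have "\<dots> \<le> (\<Sum>i. ennreal (a i))"
  proof (intro suminf_le allI)
    fix i
    have split: "exp (y - (l i)\<^sup>2 / 2) = exp (- (l i)\<^sup>2 / 2) * exp y" for y
      by (simp flip: exp_add)
    have "(\<integral>\<^sup>+x. ennreal (a i * exp (l i * (f i x - (LINT y|M. f i y)) - (l i)\<^sup>2 / 2)) \<partial>M)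
      = (\<integral>\<^sup>+x. ennreal (a i * exp (- (l i)\<^sup>2 / 2)) * ennreal (exp (l i * (f i x - (LINT y|M. f i y)))) \<partial>M)"
      using a[of i] by (simp add: split mult.assoc flip: ennreal_mult)
    also have "\<dots> \<le> ennreal (a i * exp (- (l i)\<^sup>2 / 2)) * ennreal (exp ((l i)\<^sup>2 / 2))"
      by (subst nn_integral_cmult)
         (auto intro!: mult_left_mono nn_integral_exp_centered_le bd l prob_space_axioms)
    also have "\<dots> = ennreal (a i)"
      using a[of i] by (simp add: exp_minus field_simps flip: ennreal_mult)
    finally show "(\<integral>\<^sup>+x. ennreal (a i * exp (l i * (f i x - (LINT y|M. f i y)) - (l i)\<^sup>2 / 2)) \<partial>M) \<le> ennreal (a i)" .
  qed auto
  also have "\<dots> \<le> ennreal W" by fact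
  finally show False
    by (simp add: emeasure_space_1)
qed

text \<open>The potential starts at \<open>suminf w\<close> and never grows. All its terms are
  nonnegative, so each one alone stays below \<open>suminf w\<close>; taking logarithms gives the
  bound for every \<open>i\<close> and \<open>J\<close> at once, with \<open>w i\<close> entering
  only through its logarithm.\<close>

lemma hoeffding_selection:
  fixes M :: "nat \<Rightarrow> 'a measure" and f :: "nat \<Rightarrow> 'a \<Rightarrow> real" and l w :: "nat \<Rightarrow> real"
  assumes prob: "\<And>j. prob_space (M j)" and meas: "\<And>i j. f i \<in> borel_measurable (M j)"
    and bd: "\<And>i j x. x \<in> space (M j) \<Longrightarrow> \<bar>f i x\<bar> \<le> 1"
    and l: "\<And>i. l i > 0" and w: "\<And>i. w i > 0" "summable w"
  obtains p where "\<And>j. p j \<in> space (M j)"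
    "\<And>i J. (\<Sum>j<J. f i (p j) - (LINT x|M j. f i x)) \<le> l i * real J / 2 + ln (suminf w / w i) / l i"
proof -
  define Phi where "Phi J S = (\<Sum>i. ennreal (w i * exp (l i * S i - real J * (l i)\<^sup>2 / 2)))" for J S
  \<comment> \<open>The state is the last chosen point together with all centred sums so far. The
    clause for n = 0 makes these sums start at 0, the base case for identifying
    \<open>snd (h J)\<close> with the partial sums.\<close>
  define P where "P n xS \<longleftrightarrow> Phi n (snd xS) \<le> ennreal (suminf w) \<and> (n = 0 \<longrightarrow> snd xS = (\<lambda>_. 0))" for n and xS :: "'a \<times> (nat \<Rightarrow> real)"
  define Q where "Q n xS yT \<longleftrightarrow> fst yT \<in> space (M n) \<and>
      snd yT = (\<lambda>i. snd xS i + (f i (fst yT) - (LINT x|M n. f i x)))"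
    for n and xS yT :: "'a \<times> (nat \<Rightarrow> real)"
  have "\<exists>h. \<forall>n. P n (h n) \<and> Q n (h n) (h (Suc n)) "
  proof (rule dependent_nat_choice)
    have "P 0 (undefined, \<lambda>_. 0)"
      using w by (simp add: P_def Phi_def suminf_ennreal2 less_imp_le)
    then show "\<exists>x. P 0 x" ..
  next
    fix xS :: "'a \<times> (nat \<Rightarrow> real)" and n
    obtain x S where xS: "xS = (x, S)" by (cases xS)
    assume "P n xS"
    then have le: "(\<Sum>i. ennreal (w i * exp (l i * S i - real n * (l i)\<^sup>2 / 2))) \<le> ennreal (suminf w)"
      by (simp add: P_def Phi_def xS)
    have "\<exists>y\<in>space (M n). (\<Sum>i. ennreal ((w i * exp (l i * S i - real n * (l i)\<^sup>2 / 2)) *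
          exp (l i * (f i y - (LINT x|M n. f i x)) - (l i)\<^sup>2 / 2))) \<le> ennreal (suminf w)"
      by (rule hoeffding_potential_step[OF prob meas bd l _ le]) (use w(1) in \<open>simp_all add: less_imp_le\<close>)
    then obtain y where y: "y \<in> space (M n)"
      "(\<Sum>i. ennreal ((w i * exp (l i * S i - real n * (l i)\<^sup>2 / 2)) *
          exp (l i * (f i y - (LINT x|M n. f i x)) - (l i)\<^sup>2 / 2))) \<le> ennreal (suminf w)"
      by blast
    have "(w i * exp (l i * S i - real n * (l i)\<^sup>2 / 2)) * exp (l i * (f i y - (LINT x|M n. f i x)) - (l i)\<^sup>2 / 2)
       = w i * exp (l i * (S i + (f i y - (LINT x|M n. f i x))) - real (Suc n) * (l i)\<^sup>2 / 2)" for i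
      by (simp add: field_simps flip: exp_add)
    with y show "\<exists>yT. P (Suc n) yT \<and> Q n xS yT"
      by (intro exI[of _ "(y, \<lambda>i. S i + (f i y - (LINT x|M n. f i x)))"])
         (simp add: P_def Q_def Phi_def xS)
  qed
  then obtain h where h: "\<And>n. P n (h n)" "\<And>n. Q n (h n) (h (Suc n))"
    by blast
  \<comment> \<open>Stage 0 carries a dummy point, so the j-th chosen point sits at stage
    \<open>Suc j\<close>.\<close>
  define p where "p j = fst (h (Suc j))" for j
  have S: "snd (h J) i = (\<Sum>j<J. f i (p j) - (LINT x|M j. f i x))" for i J
    using h(2) h(1)[of 0] by (induction J) (auto simp: Q_def P_def p_def)
  show ?thesis
  proof
    show "p j \<in> space (M j)" for j
      using h(2)[of j] by (simp add: Q_def p_def)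
    fix i J
    define D where "D = (\<Sum>j<J. f i (p j) - (LINT x|M j. f i x))"
    have "ennreal (w i * exp (l i * D - real J * (l i)\<^sup>2 / 2)) \<le> Phi J (snd (h J))"
      unfolding Phi_def S D_def
      using sum_le_suminf[of "\<lambda>i. ennreal (w i * exp (l i * (\<Sum>j<J. f i (p j) - (LINT x|M j. f i x))
          - real J * (l i)\<^sup>2 / 2))" "{i}"] by simp
    also have "\<dots> \<le> ennreal (suminf w)"
      using h(1)[of J] by (simp add: P_def)
    finally have "exp (l i * D - real J * (l i)\<^sup>2 / 2) \<le> suminf w / w i"
      using w(1)[of i] suminf_pos[OF w(2,1)] by (subst (asm) ennreal_le_iff) (simp_all add: field_simps)
    then have "l i * D - real J * (l i)\<^sup>2 / 2 \<le> ln (suminf w / w i)"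
      using w(1)[of i] suminf_pos[OF w(2,1)] by (subst ln_ge_iff) simp_all
    then show "D \<le> l i * real J / 2 + ln (suminf w / w i) / l i"
      using l[of i] by (simp add: field_simps power2_eq_square)
  qed
qed


section \<open>Simultaneous bounds for rational frequencies\<close>

lemma prod_encode_less_square: "prod_encode (a, b) < (a + b + 1)\<^sup>2"
  by (simp add: prod_encode_def triangle_def power2_eq_square algebra_simps)

lemma int_encode_le: "real (int_encode m) \<le> 2 * \<bar>real_of_int m\<bar>"
  by (auto simp: int_encode_def sum_encode_def)

text \<open>Codes the test function with frequency \<open>m / (n + 1)\<close> and phase \<open>r \<pi> / 2\<close>. What matters is
  that the code is polynomial in \<open>n\<close> and \<open>\<bar>m\<bar>\<close>, so that the weights \<open>1 / (i + 1)\<^sup>2\<close> cost only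
  logarithmic terms.\<close>

definition freq_code :: "nat \<Rightarrow> int \<Rightarrow> nat \<Rightarrow> nat" where
  "freq_code n m r = prod_encode (prod_encode (n, int_encode m), r)"

text \<open>Each of the two nested pairings at most squares the size, hence the fourth power; 256 is
  (4 * 2^2)^2. The product form separates the denominator from the frequency once logarithms are
  taken.\<close>

lemma freq_code_less:
  assumes "r < 4"
  shows "real (freq_code n m r) + 1 \<le> 256 * ((real n + 1) * (\<bar>real_of_int m\<bar> / (real n + 1) + 1)) ^ 4"
proof -
  define a where "a = prod_encode (n, int_encode m)"
  have "real (a + 1) \<le> real ((n + int_encode m + 1)\<^sup>2)"
    using prod_encode_less_square[of n "int_encode m"] unfolding a_def by (intro of_nat_mono) linarith
  also have "\<dots> \<le> (2 * (real n + 1 + \<bar>real_of_int m\<bar>))\<^sup>2"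
    using int_encode_le[of m] unfolding of_nat_power by (intro power_mono) auto
  finally have a: "real (a + 1) \<le> (2 * (real n + 1 + \<bar>real_of_int m\<bar>))\<^sup>2" .
  have "real (freq_code n m r + 1) \<le> real ((a + r + 1)\<^sup>2)"
    using prod_encode_less_square[of a r] unfolding a_def freq_code_def by (intro of_nat_mono) linarith
  also have "\<dots> \<le> (4 * real (a + 1))\<^sup>2"
    using assms unfolding of_nat_power by (intro power_mono) auto
  also have "\<dots> \<le> (4 * (2 * (real n + 1 + \<bar>real_of_int m\<bar>))\<^sup>2)\<^sup>2"
    using a by (intro power_mono mult_left_mono) auto
  also have "real n + 1 + \<bar>real_of_int m\<bar> = (real n + 1) * (\<bar>real_of_int m\<bar> / (real n + 1) + 1)"
    by (simp add: field_simps)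
  finally show ?thesis
    by (simp add: power_mult_distrib flip: power_mult)
qed

lemma ln_freq_code_le:
  assumes "r < 4"
  shows "ln (real (freq_code n m r) + 1)
    \<le> 12 * (ln (real n + 2) + ln (\<bar>real_of_int m\<bar> / (real n + 1) + 1))"
proof -
  define E where "E = ln (\<bar>real_of_int m\<bar> / (real n + 1) + 1)"
  have pos: "\<bar>real_of_int m\<bar> / (real n + 1) + 1 > 0" "real n + 1 > 0"
    by (simp_all add: add_nonneg_pos)
  have "ln (real (freq_code n m r) + 1)
      \<le> ln (256 * ((real n + 1) * (\<bar>real_of_int m\<bar> / (real n + 1) + 1)) ^ 4)"
    using freq_code_less[OF assms, of n m] by (subst ln_le_cancel_iff) (use pos in auto)
  also have "\<dots> = ln (2 ^ 8) + 4 * (ln (real n + 1) + E)"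
    using pos by (simp add: ln_mult ln_realpow E_def)
  \<comment> \<open>The constant 256 = 2^8 is absorbed by ln 2 \<le> ln (n + 2), giving 8 + 4 =
    12.\<close>
  also have "\<dots> \<le> 8 * ln (real n + 2) + 4 * (ln (real n + 2) + E)"
    using ln_realpow[of 2 8] by (intro add_mono mult_left_mono) auto
  also have "\<dots> \<le> 12 * (ln (real n + 2) + E)"
    by (auto simp: E_def algebra_simps)
  finally show ?thesis by (simp add: E_def)
qed

text \<open>Write N = n + 1, L = ln (n + 2) and H for the logarithmic cost of the code. The
  parameter l = sqrt (L H / N) balances l K against H / l when K is of order N / L, the size that
  the Chebyshev bound allows.\<close>

lemma cis_selection:
  fixes M :: "nat \<Rightarrow> 'a measure" and h :: "'a \<Rightarrow> real"
  assumes prob: "\<And>j. prob_space (M j)" and h: "\<And>j. h \<in> borel_measurable (M j)"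
  defines "l \<equiv> \<lambda>n m. sqrt (ln (real n + 2) *
    (ln (real n + 2) + ln (\<bar>real_of_int m\<bar> / (real n + 1) + 1)) / (real n + 1))"
  obtains p A where "\<And>j. p j \<in> space (M j)" "A \<ge> 0"
    "\<And>n m K. cmod (\<Sum>j<K. cis (real_of_int m / (real n + 1) * h (p j)) -
        (LINT x|M j. cis (real_of_int m / (real n + 1) * h x)))
      \<le> A * (l n m * real K + (ln (real n + 2) + ln (\<bar>real_of_int m\<bar> / (real n + 1) + 1)) / l n m)"
proof -
  define nn where "nn i = fst (prod_decode (fst (prod_decode i)))" for i
  define mm where "mm i = int_decode (snd (prod_decode (fst (prod_decode i))))" for i
  define rr where "rr i = snd (prod_decode i)" for i
  have dec: "nn (freq_code n m r) = n" "mm (freq_code n m r) = m" "rr (freq_code n m r) = r" for n m r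
    by (simp_all add: nn_def mm_def rr_def freq_code_def)
  define f where "f i x = cos (real_of_int (mm i) / (real (nn i) + 1) * h x + real (rr i) * (pi / 2))" for i x
  define w :: "nat \<Rightarrow> real" where "w i = 1 / (real i + 1) ^ 2" for i
  have E_nonneg: "0 \<le> ln (\<bar>real_of_int m\<bar> / (real n + 1) + 1)" for n m
    by simp
  have l: "l n m > 0" for n m
  proof -
    have "ln (real n + 2) > 0" by simp
    with E_nonneg[of m n] show ?thesis
      unfolding l_def by (simp add: add_pos_nonneg)
  qed
  have w: "w i > 0" "summable w" for i
    using inverse_squares_sums unfolding w_def by (auto simp: sums_iff add.commute)
  obtain p where p: "\<And>j. p j \<in> space (M j)"
    and D: "\<And>i J. (\<Sum>j<J. f i (p j) - (LINT x|M j. f i x))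
      \<le> l (nn i) (mm i) * real J / 2 + ln (suminf w / w i) / l (nn i) (mm i)"
  proof (rule hoeffding_selection[of M f "\<lambda>i. l (nn i) (mm i)" w])
    show "f i \<in> borel_measurable (M j)" for i j
      using h[of j] unfolding f_def by measurable
  qed (use prob l w in \<open>auto simp: f_def\<close>)
  \<comment> \<open>24 is twice the 12 of \<open>ln_freq_code_le\<close>, since the weights are
    inverse squares; the other summand turns the constant ln (suminf w) into a multiple of H, using
    H \<ge> ln 2.\<close>
  define A where "A = max 0 (ln (suminf w)) / ln 2 + 24"
  have A: "A \<ge> 24" by (simp add: A_def)
  have lnA: "ln (suminf w / w (freq_code n m r)) \<le> A * (ln (real n + 2) + ln (\<bar>real_of_int m\<bar> / (real n + 1) + 1))"
    if "r < 4" for n m r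
  proof -
    define H where "H = ln (real n + 2) + ln (\<bar>real_of_int m\<bar> / (real n + 1) + 1)"
    have "ln 2 \<le> ln (real n + 2)" by simp
    then have "ln 2 \<le> H"
      unfolding H_def using E_nonneg[of m n] by linarith
    have "ln (suminf w) \<le> max 0 (ln (suminf w)) / ln 2 * ln 2" by simp
    also have "\<dots> \<le> max 0 (ln (suminf w)) / ln 2 * H"
      using \<open>ln 2 \<le> H\<close> by (intro mult_left_mono) auto
    finally have W: "ln (suminf w) \<le> max 0 (ln (suminf w)) / ln 2 * H" .
    have "ln (suminf w / w (freq_code n m r)) = ln (suminf w * (real (freq_code n m r) + 1)\<^sup>2)"
      by (simp add: w_def)
    also have "\<dots> = ln (suminf w) + 2 * ln (real (freq_code n m r) + 1)"
      using suminf_pos[OF w(2,1)] by (simp add: ln_mult ln_realpow add_nonneg_pos)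
    also have "\<dots> \<le> A * H"
      using W ln_freq_code_le[OF that, of n m] by (simp add: A_def H_def algebra_simps)
    finally show ?thesis by (simp add: H_def)
  qed
  show ?thesis
  proof
    fix n m K
    define \<phi> where "\<phi> x = real_of_int m / (real n + 1) * h x" for x
    define z where "z = (\<Sum>j<K. cis (\<phi> (p j)) - (LINT x|M j. cis (\<phi> x)))"
    define B where "B = 2 * A * (l n m * real K + (ln (real n + 2) + ln (\<bar>real_of_int m\<bar> / (real n + 1) + 1)) / l n m)"
    \<comment> \<open>For r = 0, 1, 2, 3 the left side is Re z, -Im z, -Re z, Im z, so four
      one-sided bounds control |Re z| and |Im z|.\<close>
    have rot: "Re (cis (real r * (pi / 2)) * z) \<le> B / 2" if "r < 4" for r
    proof -
      have "Re (cis (real r * (pi / 2)) * (LINT x|M j. cis (\<phi> x))) = (LINT x|M j. f (freq_code n m r) x)" for j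
      proof -
        interpret prob_space "M j" by (rule prob)
        have [measurable]: "h \<in> borel_measurable (M j)" by (rule h)
        have "integrable (M j) (\<lambda>x. cis (\<phi> x + real r * (pi / 2)))"
          unfolding \<phi>_def cis_conv_exp by (intro integrable_const_bound[of _ 1]) auto
        then have "Re (LINT x|M j. cis (\<phi> x + real r * (pi / 2))) = (LINT x|M j. f (freq_code n m r) x)"
          by (subst integral_Re[symmetric]) (simp_all add: f_def[abs_def] dec \<phi>_def)
        then show ?thesis
          by (simp add: mult.commute flip: cis_mult)
      qed
      then have "Re (cis (real r * (pi / 2)) * z) = (\<Sum>j<K. f (freq_code n m r) (p j) - (LINT x|M j. f (freq_code n m r) x))"
        by (simp add: z_def sum_distrib_left right_diff_distrib cis_mult f_def dec \<phi>_def add.commute)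
      also have "\<dots> \<le> l n m * real K / 2 + ln (suminf w / w (freq_code n m r)) / l n m"
        using D[of "freq_code n m r" K] by (simp add: dec)
      also have "\<dots> \<le> A * (l n m * real K) +
          A * (ln (real n + 2) + ln (\<bar>real_of_int m\<bar> / (real n + 1) + 1)) / l n m"
      proof (intro add_mono divide_right_mono lnA that)
        have "1 / 2 * (l n m * real K) \<le> A * (l n m * real K)"
          using A l[of n m] by (intro mult_right_mono) auto
        then show "l n m * real K / 2 \<le> A * (l n m * real K)" by simp
      qed (use l[of n m] in simp)
      also have "\<dots> = B / 2"
        by (simp add: B_def distrib_left)
      finally show ?thesis .
    qed
    have "cos (3 * pi / 2) = 0" "sin (3 * pi / 2) = -1"
      using cos_3over2_pi sin_3over2_pi by simp_all
    then have "\<bar>Re z\<bar> \<le> B / 2" "\<bar>Im z\<bar> \<le> B / 2"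
      using rot[of 0] rot[of 1] rot[of 2] rot[of 3] by (auto simp: abs_le_iff)
    then have "cmod z \<le> B"
      using cmod_le[of z] by linarith
    then show "cmod (\<Sum>j<K. cis (real_of_int m / (real n + 1) * h (p j)) -
        (LINT x|M j. cis (real_of_int m / (real n + 1) * h x))) \<le> 2 * A * (l n m * real K +
          (ln (real n + 2) + ln (\<bar>real_of_int m\<bar> / (real n + 1) + 1)) / l n m)"
      by (simp add: z_def \<phi>_def B_def)
  qed (use p A in auto)
qed

section \<open>Perturbing the frequency, and the size of the tuned bound\<close>

lemma norm_cis_diff_le: "cmod (cis a - cis b) \<le> \<bar>a - b\<bar>"
proof -
  have "cis a - cis b = cis b * (cis (a - b) - 1)"
    by (simp add: right_diff_distrib cis_mult)
  then have "cmod (cis a - cis b) = cmod (exp (\<i> * of_real (a - b)) - 1)"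
    by (simp add: norm_mult cis_conv_exp)
  also have "\<dots> \<le> \<bar>a - b\<bar>"
    unfolding dist_exp_i_1 using abs_sin_x_le_abs_x[of "(a - b) / 2"] by simp
  finally show ?thesis .
qed

text \<open>With R = sqrt (H N / L) one has H / l = R exactly, and l K = (L / N) K R \<le> 2 C R by
  the hypothesis on \<open>K\<close>. It remains to see that R^2 is at most 4 x + 4 x E / ln (x + 1)
  and to split the square root.\<close>

lemma optimised_bound_le:
  fixes x t C :: real and n K :: nat and m :: int
  assumes x: "1 \<le> x" "x \<le> real n + 1" "real n + 1 \<le> x + 1"
    and m: "\<bar>real_of_int m\<bar> / (real n + 1) \<le> \<bar>t\<bar> + 1"
    and K: "real K * ln (x + 1) \<le> C * x" and C: "0 \<le> C"
  defines "H \<equiv> ln (real n + 2) + ln (\<bar>real_of_int m\<bar> / (real n + 1) + 1)"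
  defines "l \<equiv> sqrt (ln (real n + 2) * H / (real n + 1))"
  shows "l * real K + H / l \<le> (4 * C + 2) * (sqrt x + sqrt (x * ln (\<bar>t\<bar> + 1) / ln (x + 1)))"
proof -
  define L N E where "L = ln (real n + 2)" and "N = real n + 1" and "E = ln (\<bar>t\<bar> + 1)"
  define R where "R = sqrt (H * N / L)"
  have N: "x \<le> N" "N \<le> 2 * x" "0 < N" using x by (auto simp: N_def)
  have L2: "ln 2 \<le> L" unfolding L_def by simp
  have lx: "0 < ln (x + 1)" using x by simp
  \<comment> \<open>This makes ln (n + 2) and ln (x + 1) equal up to a factor 2.\<close>
  have "real n + 2 \<le> (x + 1) ^ 2"
    using x mult_mono[of 1 x 1 x] by (simp add: power2_eq_square algebra_simps)
  then have "L \<le> ln ((x + 1) ^ 2)"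
    unfolding L_def using x by (subst ln_le_cancel_iff) auto
  then have Lle: "L \<le> 2 * ln (x + 1)" using x by (simp add: ln_realpow)
  have Lge: "ln (x + 1) \<le> L" unfolding L_def using x by simp
  have "ln (\<bar>real_of_int m\<bar> / (real n + 1) + 1) \<le> ln (2 * (\<bar>t\<bar> + 1))"
    using m by (subst ln_le_cancel_iff) (auto simp: add_nonneg_pos)
  also have "\<dots> = ln 2 + E" using ln_mult[of 2 "\<bar>t\<bar> + 1"] by (simp add: E_def)
  finally have H: "H \<le> 2 * L + E" unfolding H_def L_def[symmetric] using L2 by linarith
  have "L > 0" using Lge lx by linarith
  have "H > 0"
    using \<open>L > 0\<close> unfolding H_def L_def[symmetric] by (simp add: add_pos_nonneg)
  have "l = L / N * R"
    unfolding l_def R_def L_def[symmetric] N_def[symmetric] using \<open>L > 0\<close> \<open>H > 0\<close> \<open>0 < N\<close>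
    by (intro real_sqrt_unique) (auto simp: power_mult_distrib power2_eq_square field_simps)
  have "R > 0" using \<open>L > 0\<close> \<open>H > 0\<close> \<open>0 < N\<close> by (simp add: R_def)
  have "R ^ 2 = H * N / L" using \<open>L > 0\<close> \<open>H > 0\<close> \<open>0 < N\<close> by (simp add: R_def)
  then have Hl: "H / l = R"
    unfolding \<open>l = L / N * R\<close> using \<open>L > 0\<close> \<open>R > 0\<close> \<open>0 < N\<close> by (simp add: field_simps power2_eq_square)
  have "L * real K \<le> 2 * ln (x + 1) * real K"
    using Lle by (intro mult_right_mono) auto
  also have "\<dots> \<le> 2 * C * x" using K by (simp add: mult_ac)
  also have "\<dots> \<le> 2 * C * N" using N C by (intro mult_left_mono) auto
  finally have "L / N * real K \<le> 2 * C" using N by (simp add: field_simps)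
  then have "l * real K \<le> 2 * C * R"
    using mult_right_mono[of "L / N * real K" "2 * C" R] \<open>R > 0\<close> by (simp add: \<open>l = L / N * R\<close> mult_ac)
  with Hl have le: "l * real K + H / l \<le> (2 * C + 1) * R" by (simp add: distrib_right)
  have "H * N / L \<le> (2 * L + E) * (2 * x) / L"
    using H N \<open>L > 0\<close> \<open>H > 0\<close> x by (intro divide_right_mono mult_mono) auto
  also have "\<dots> = 4 * x + 2 * (x * E) / L" using \<open>L > 0\<close> by (simp add: field_simps)
  also have "\<dots> \<le> 4 * x + 2 * (x * E) / ln (x + 1)"
    using Lge lx \<open>L > 0\<close> x by (intro add_left_mono divide_left_mono) (auto simp: E_def)
  also have "\<dots> \<le> 4 * x + 4 * (x * E / ln (x + 1))"
    using lx x by (auto simp: E_def divide_right_mono)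
  finally have "R \<le> sqrt (4 * x + 4 * (x * E / ln (x + 1)))"
    unfolding R_def by (rule real_sqrt_le_mono)
  also have "\<dots> \<le> sqrt (4 * x) + sqrt (4 * (x * E / ln (x + 1)))"
    using x lx by (intro sqrt_add_le_add_sqrt) (auto simp: E_def)
  also have "\<dots> = 2 * (sqrt x + sqrt (x * E / ln (x + 1)))"
    unfolding real_sqrt_mult by simp
  finally have "(2 * C + 1) * R \<le> (2 * C + 1) * (2 * (sqrt x + sqrt (x * E / ln (x + 1))))"
    using C by (intro mult_left_mono) auto
  with le show ?thesis by (simp add: E_def algebra_simps)
qed

section \<open>Integrals over half-open intervals and sums over initial segments\<close>

lemma set_integrable_bounded_Ioc:
  fixes g :: "real \<Rightarrow> 'a :: {banach, second_countable_topology}"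
  assumes "g \<in> borel_measurable borel" "\<And>s. a < s \<Longrightarrow> s \<le> b \<Longrightarrow> norm (g s) \<le> c"
  shows "set_integrable lborel {a<..b} g"
  unfolding set_integrable_def using assms
  by (intro integrableI_bounded_set_indicator[of _ _ _ c]) (cases "a \<le> b"; auto)+

lemma norm_set_integral_Ioc_le:
  fixes g :: "real \<Rightarrow> complex"
  assumes "g \<in> borel_measurable borel" "\<And>s. a < s \<Longrightarrow> s \<le> b \<Longrightarrow> cmod (g s) \<le> c" and "a \<le> b"
  shows "cmod (LINT s:{a<..b}|lborel. g s) \<le> c * (b - a)"
proof -
  have "cmod (LINT s:{a<..b}|lborel. g s) \<le> (LINT s:{a<..b}|lborel. cmod (g s))"
    using set_integrable_bounded_Ioc[OF assms(1,2)] by (rule set_integral_norm_bound)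
  also have "\<dots> \<le> (LINT s:{a<..b}|lborel. c)"
    using set_integrable_bounded_Ioc[OF assms(1,2)] set_integrable_bounded_Ioc[of "\<lambda>_. c" a b "\<bar>c\<bar>"] assms(2)
    by (intro set_integral_mono set_integrable_norm) auto
  also have "\<dots> = c * (b - a)"
    using \<open>a \<le> b\<close> by (simp add: set_lebesgue_integral_def mult.commute)
  finally show ?thesis .
qed

lemma set_integral_Ioc_split:
  fixes g :: "real \<Rightarrow> complex"
  assumes "g \<in> borel_measurable borel" "\<And>s. cmod (g s) \<le> c" and y: "real K \<le> y"
  shows "(LINT s:{0<..y}|lborel. g s) =
    (\<Sum>j<K. LINT s:{real j<..real j + 1}|lborel. g s) + (LINT s:{real K<..y}|lborel. g s)"
proof -
  have int: "set_integrable lborel {a<..b} g" for a b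
    using assms by (intro set_integrable_bounded_Ioc)
  have split: "(LINT s:{0<..b}|lborel. g s) = (LINT s:{0<..a}|lborel. g s) + (LINT s:{a<..b}|lborel. g s)"
    if "0 \<le> a" "a \<le> b" for a b
    using that int by (subst set_integral_Un[symmetric]) (auto simp: ivl_disj_un)
  have "(LINT s:{0<..real K}|lborel. g s) = (\<Sum>j<K. LINT s:{real j<..real j + 1}|lborel. g s)"
  proof (induction K)
    case 0
    show ?case by (simp add: set_lebesgue_integral_def)
  next
    case (Suc K)
    show ?case
      using split[of "real K" "real K + 1"] Suc by (simp add: add.commute)
  qed
  with split[OF _ y] show ?thesis by simp
qed

lemma powr_minus_ii_eq_cis: "0 < u \<Longrightarrow> complex_of_real u powr (- (\<i> * complex_of_real t)) = cis (- t * ln u)"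
  by (simp add: powr_def cis_conv_exp Ln_of_real mult_ac)

text \<open>Meant for S = {j. p j \<le> x} and K the integer part of F(x): only the membership of
  the index K is undecided.\<close>

lemma card_between:
  fixes S :: "nat set"
  assumes "{..<K} \<subseteq> S" "S \<subseteq> {..K}"
  shows "finite S" "K \<le> card S" "card S \<le> K + 1"
  using assms card_mono[of S "{..<K}"] card_mono[of "{..K}" S] finite_subset[of S "{..K}"] by auto

lemma sum_cis_initial_segment:
  fixes S :: "nat set"
  assumes "{..<K} \<subseteq> S" "S \<subseteq> {..K}"
  shows "cmod ((\<Sum>j\<in>S. cis (a j)) - (\<Sum>j<K. cis (a j))) \<le> 1"
proof -
  consider "S = {..<K}" | "S = insert K {..<K}"
    using assms by (auto simp: lessThan_Suc_atMost[symmetric] lessThan_Suc)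
  then show ?thesis by cases auto
qed

section \<open>The lower inverse of \<open>F\<close>\<close>

locale unbounded_rcont_mono =
  fixes F :: "real \<Rightarrow> real"
  assumes mono: "mono_on {1..} F"
    and rcont: "\<And>x. x \<ge> 1 \<Longrightarrow> continuous (at_right x) F"
    and F1: "F 1 = 0"
    and Finf: "filterlim F at_top at_top"
begin

definition quantile :: "real \<Rightarrow> real" where
  "quantile s = Inf {x. 1 \<le> x \<and> s \<le> F x}"

lemma F_mono: "1 \<le> x \<Longrightarrow> x \<le> y \<Longrightarrow> F x \<le> F y"
  using mono by (auto simp: mono_on_def)

lemma F_nonneg: "1 \<le> x \<Longrightarrow> 0 \<le> F x"
  using F_mono[of 1 x] F1 by simp

lemma F_ge_ex: "\<exists>x\<ge>1. s \<le> F x"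
proof -
  have "\<forall>\<^sub>F x in at_top. 1 \<le> x \<and> s \<le> F x"
    using Finf by (intro eventually_conj eventually_ge_at_top) (auto simp: filterlim_at_top)
  then show ?thesis
    by (auto simp: eventually_at_top_linorder)
qed

lemma quantile_ge_1: "1 \<le> quantile s"
  unfolding quantile_def using F_ge_ex[of s] by (intro cInf_greatest) auto

text \<open>Right-continuity makes the infimum attained, that is, s \<le> F (quantile s);
  monotonicity does the rest.\<close>

lemma quantile_le_iff:
  assumes "1 \<le> x"
  shows "quantile s \<le> x \<longleftrightarrow> s \<le> F x"
proof
  have bdd: "bdd_below {x. 1 \<le> x \<and> s \<le> F x}"
    by (rule bdd_belowI[of _ 1]) simp
  show "quantile s \<le> x" if "s \<le> F x"
    unfolding quantile_def using that assms by (intro cInf_lower bdd) simp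
  have "s \<le> F (quantile s)"
  proof (rule ccontr)
    assume "\<not> s \<le> F (quantile s)"
    then have "\<forall>\<^sub>F y in at_right (quantile s). F y < s"
      using rcont[OF quantile_ge_1, of s] by (intro order_tendstoD) (auto simp: continuous_within)
    \<comment> \<open>\<open>F\<close> would stay below \<open>s\<close> on a right neighbourhood of
      the infimum, yet the set must contain points arbitrarily close to its infimum.\<close>
    then obtain b where b: "b > quantile s" "\<And>y. quantile s < y \<Longrightarrow> y < b \<Longrightarrow> F y < s"
      by (auto simp: eventually_at_right_field)
    obtain y where y: "1 \<le> y" "s \<le> F y" "y < b"
      using cInf_lessD[of "{x. 1 \<le> x \<and> s \<le> F x}" b] b(1) F_ge_ex[of s] by (auto simp: quantile_def)
    have "quantile s \<le> y"
      unfolding quantile_def using y by (intro cInf_lower bdd) simp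
    with y b(2)[of y] \<open>\<not> s \<le> F (quantile s)\<close> show False
      by (cases "y = quantile s") auto
  qed
  then show "s \<le> F x" if "quantile s \<le> x"
    using F_mono[OF quantile_ge_1 that] by simp
qed

lemma mono_quantile: "Fun.mono quantile"
  by (metis monoI order.trans order.refl quantile_ge_1 quantile_le_iff)

lemma quantile_gt_1: "0 < s \<Longrightarrow> 1 < quantile s"
  using quantile_le_iff[of 1 s] F1 by (simp flip: not_le)

lemma filterlim_quantile: "filterlim quantile at_top at_top"
  unfolding filterlim_at_top
proof
  fix Z :: real
  have "Z \<le> quantile s" if "F (max Z 1) < s" for s
    using quantile_le_iff[of "max Z 1" s] that by (auto simp flip: not_le)
  then show "\<forall>\<^sub>F s in at_top. Z \<le> quantile s"
    by (auto intro: eventually_mono[OF eventually_gt_at_top[of "F (max Z 1)"]])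
qed

text \<open>The quantile is constant only across jumps of \<open>F\<close>. A continuous
  \<open>F\<close> attains the value s, so F (quantile s) \<le> s < s'.\<close>

lemma quantile_strict_mono:
  assumes "continuous_on {1..} F" "0 < s" "s < s'"
  shows "quantile s < quantile s'"
proof -
  obtain y where y: "1 \<le> y" "s \<le> F y"
    using F_ge_ex by blast
  obtain x where x: "1 \<le> x" "F x = s"
    using IVT'[of F 1 s y] y F1 assms continuous_on_subset[OF assms(1), of "{1..y}"] by auto
  have "quantile s \<le> x"
    using x by (simp add: quantile_le_iff)
  then have "F (quantile s) \<le> s"
    using F_mono[OF quantile_ge_1] x by blast
  with \<open>s < s'\<close> have "\<not> quantile s' \<le> quantile s"
    by (simp add: quantile_le_iff quantile_ge_1)
  then show ?thesis by simp
qed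

lemma borel_measurable_quantile [measurable]: "quantile \<in> borel_measurable borel"
  by (rule borel_measurable_mono[OF mono_quantile])

section \<open>The Stieltjes measure as an image of Lebesgue measure\<close>

lemma continuous_Fext: "continuous (at_right a) (Fext F)"
proof (cases "a \<ge> 1")
  case True
  have "(F \<longlongrightarrow> F a) (at_right a)"
    using rcont[OF True] by (simp add: continuous_within)
  then have "(Fext F \<longlongrightarrow> F a) (at_right a)"
    by (rule tendsto_cong[THEN iffD1, rotated])
       (use True in \<open>auto simp: Fext_def max_def eventually_at_filter\<close>)
  with True show ?thesis
    by (simp add: continuous_within Fext_def max_def)
next
  case False
  have "\<forall>\<^sub>F y in at_right a. 0 = Fext F y"
    using False F1 by (auto simp: eventually_at_right_field Fext_def max_def intro!: exI[of _ 1])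
  then have "(Fext F \<longlongrightarrow> 0) (at_right a)"
    by (rule tendsto_cong[THEN iffD1]) simp
  with False F1 show ?thesis
    by (simp add: continuous_within Fext_def max_def)
qed

lemma Fext_mono: "x \<le> y \<Longrightarrow> Fext F x \<le> Fext F y"
  by (auto simp: Fext_def intro!: F_mono)

lemma quantile_le_iff_Fext: "0 < s \<Longrightarrow> quantile s \<le> x \<longleftrightarrow> s \<le> Fext F x"
  using quantile_le_iff[of x s] quantile_gt_1[of s] F1 by (cases "1 \<le> x") (auto simp: Fext_def)

text \<open>The preimage of (a, b] is (Fext a, Fext b], whose length is the Stieltjes mass of (a,
  b]; such intervals form an intersection-stable generator. Restricting to s > 0 is essential: all s
  \<le> 0 are sent to 1 and would create an atom of infinite mass there.\<close>

lemma interval_measure_eq_distr_quantile: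
  "interval_measure (Fext F) = distr (restrict_space lborel {0<..}) borel quantile"
proof (rule measure_eqI_generator_eq[where E = "range (\<lambda>(a, b). {a<..b})" and \<Omega> = UNIV
      and A = "\<lambda>n. {- real n<..real n}"])
  have F0: "0 \<le> Fext F x" for x
    by (simp add: Fext_def F_nonneg)
  show "Int_stable (range (\<lambda>(a, b). {a<..b::real}))"
    by (force simp: Int_stable_def image_iff)
  fix X assume "X \<in> range (\<lambda>(a, b). {a<..b::real})"
  then obtain a b where X: "X = {a<..b}" by auto
  have "quantile -` {a<..b} \<inter> {0<..} = {Fext F a<..Fext F b}"
    using F0[of a] by (auto simp: quantile_le_iff_Fext simp flip: not_le)
  then have "emeasure (distr (restrict_space lborel {0<..}) borel quantile) X =
      emeasure (restrict_space lborel {0<..}) {Fext F a<..Fext F b}"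
    by (simp add: X emeasure_distr measurable_restrict_space1 space_restrict_space)
  also have "\<dots> = emeasure lborel {Fext F a<..Fext F b}"
    using F0[of a] by (intro emeasure_restrict_space) auto
  also have "\<dots> = emeasure (interval_measure (Fext F)) X"
    using emeasure_interval_measure_Ioc[of a b "Fext F", OF _ Fext_mono continuous_Fext] Fext_mono[of a b] Fext_mono[of b a]
    by (cases "a \<le> b") (simp_all add: X)
  finally show "emeasure (interval_measure (Fext F)) X =
      emeasure (distr (restrict_space lborel {0<..}) borel quantile) X" ..
next
  show "(\<Union>i. {- real i<..real i}) = UNIV"
    by (auto simp: minus_less_iff) (meson less_imp_le max_less_iff_conj reals_Archimedean2)
  show "emeasure (interval_measure (Fext F)) {- real i<..real i} \<noteq> \<infinity>" for i
    using emeasure_interval_measure_Ioc[of "- real i" "real i" "Fext F", OF _ Fext_mono continuous_Fext]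
    by simp
qed (auto simp: borel_sigma_sets_Ioc)

lemma stieltjes_int_eq_quantile:
  assumes [measurable]: "g \<in> borel_measurable borel" and "1 \<le> x"
  shows "stieltjes_int F g x = (LINT s:{0<..F x}|lborel. g (quantile s))"
proof -
  have [measurable]: "(\<lambda>u. indicator {1<..x} u *\<^sub>R g u) \<in> borel_measurable borel"
    by (intro borel_measurable_scaleR borel_measurable_indicator) auto
  have "stieltjes_int F g x =
      (LINT u|distr (restrict_space lborel {0<..}) borel quantile. indicator {1<..x} u *\<^sub>R g u)"
    by (simp add: stieltjes_int_def set_lebesgue_integral_def interval_measure_eq_distr_quantile)
  also have "\<dots> = (LINT s|restrict_space lborel {0<..}. indicator {1<..x} (quantile s) *\<^sub>R g (quantile s))"
    by (rule integral_distr) (simp_all add: measurable_restrict_space1)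
  also have "\<dots> = (LINT s|lborel. indicator {0<..} s *\<^sub>R (indicator {1<..x} (quantile s) *\<^sub>R g (quantile s)))"
    by (rule integral_restrict_space) simp
  also have "\<dots> = (LINT s:{0<..F x}|lborel. g (quantile s))"
    unfolding set_lebesgue_integral_def using \<open>1 \<le> x\<close>
    by (intro Bochner_Integration.integral_cong) (auto simp: indicator_def quantile_le_iff quantile_gt_1)
  finally show ?thesis .
qed

text \<open>Replacing ln x by ln (x + 1) avoids the zero at x = 1 and makes the bound uniform. For
  large x it costs a factor 2, as x + 1 \<le> x^2; below \<open>x1\<close> monotonicity bounds the
  left side by its value at \<open>x1\<close>, which is added to the constant.\<close>

lemma chebyshev_bound:
  assumes "F \<in> O(\<lambda>x. x / ln x)"
  obtains C where "0 \<le> C" "\<And>x. 1 \<le> x \<Longrightarrow> F x * ln (x + 1) \<le> C * x"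
proof -
  obtain c where c: "c > 0" "\<forall>\<^sub>F x in at_top. norm (F x) \<le> c * norm (x / ln x)"
    using assms by (rule landau_o.bigE)
  then obtain x0 where x0: "\<And>x. x0 \<le> x \<Longrightarrow> norm (F x) \<le> c * norm (x / ln x)"
    by (auto simp: eventually_at_top_linorder)
  define x1 where "x1 = max x0 2"
  have x1: "x1 \<ge> 2" "x1 \<ge> x0" by (auto simp: x1_def)
  define C where "C = 2 * c + F x1 * ln (x1 + 1)"
  have C1: "0 \<le> F x1 * ln (x1 + 1)"
    using x1 by (intro mult_nonneg_nonneg F_nonneg) auto
  have "F x * ln (x + 1) \<le> C * x" if "1 \<le> x" for x
  proof (cases "x1 \<le> x")
    case True
    then have "2 \<le> x" using x1 by simp
    have "2 * x \<le> x * x"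
      using \<open>2 \<le> x\<close> by (intro mult_right_mono) auto
    then have "x + 1 \<le> x ^ 2"
      using \<open>2 \<le> x\<close> unfolding power2_eq_square by linarith
    then have "ln (x + 1) \<le> ln (x ^ 2)" using \<open>2 \<le> x\<close> by (subst ln_le_cancel_iff) auto
    then have ln: "ln (x + 1) \<le> 2 * ln x" using \<open>2 \<le> x\<close> by (simp add: ln_realpow)
    have "0 < ln x" using \<open>2 \<le> x\<close> by simp
    have "F x \<le> c * (x / ln x)"
      using x0[of x] True x1 \<open>2 \<le> x\<close> \<open>0 < ln x\<close> by simp
    then have "F x * ln x \<le> c * x" using \<open>0 < ln x\<close> by (simp add: field_simps)
    moreover have "F x * ln (x + 1) \<le> F x * (2 * ln x)"
      using ln F_nonneg[OF that] by (rule mult_left_mono)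
    moreover have "0 \<le> F x1 * ln (x1 + 1) * x"
      using C1 that by simp
    ultimately show ?thesis by (simp add: C_def distrib_right)
  next
    case False
    have "F x * ln (x + 1) \<le> F x1 * ln (x1 + 1)"
      using False that x1 by (intro mult_mono F_mono F_nonneg) auto
    also have "\<dots> \<le> C * 1" using c by (simp add: C_def)
    also have "\<dots> \<le> C * x" using that c C1 by (intro mult_left_mono) (auto simp: C_def)
    finally show ?thesis .
  qed
  moreover have "0 \<le> C" using C1 c by (simp add: C_def)
  ultimately show ?thesis by (rule that[rotated])
qed


lemma stieltjes_int_powr:
  assumes "1 \<le> x"
  shows "stieltjes_int F (\<lambda>u. complex_of_real u powr (- (\<i> * complex_of_real t))) x =
    (LINT s:{0<..F x}|lborel. cis (- t * ln (quantile s)))"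
proof -
  have "stieltjes_int F (\<lambda>u. complex_of_real u powr (- (\<i> * complex_of_real t))) x =
      stieltjes_int F (\<lambda>u. cis (- t * ln u)) x"
    unfolding stieltjes_int_def by (intro set_lebesgue_integral_cong) (auto simp: powr_minus_ii_eq_cis)
  also have "\<dots> = (LINT s:{0<..F x}|lborel. cis (- t * ln (quantile s)))"
    using assms by (intro stieltjes_int_eq_quantile) (simp_all add: cis_conv_exp)
  finally show ?thesis .
qed

section \<open>Construction of the generalized primes\<close>

lemma generalized_primes_exist:
  assumes cheb: "F \<in> O(\<lambda>x. x / ln x)"
  obtains p C where "gen_primes p" "\<And>x. 1 \<le> x \<Longrightarrow> \<bar>real (gpi p x) - F x\<bar> \<le> 1"
    "continuous_on {1..} F \<Longrightarrow> strict_mono p"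
    "\<And>t x. 1 \<le> x \<Longrightarrow>
      norm ((\<Sum>j\<in>{j. p j \<le> x}. (complex_of_real (p j)) powr (- (\<i> * complex_of_real t)))
        - stieltjes_int F (\<lambda>u. (complex_of_real u) powr (- (\<i> * complex_of_real t))) x)
      \<le> C * (sqrt x + sqrt (x * ln (\<bar>t\<bar> + 1) / ln (x + 1)))"
proof -
  \<comment> \<open>The uniform distribution on an interval of length 1, so expectations are
    integrals over (j, j + 1] and add up to the Stieltjes integral.\<close>
  define M where "M j = restrict_space lborel {real j<..real j + 1}" for j :: nat
  define h where "h s = ln (quantile s)" for s
  have h_meas [measurable]: "h \<in> borel_measurable borel"
    unfolding h_def by measurable
  have h_nonneg: "0 \<le> h s" for s
    using quantile_ge_1[of s] by (simp add: h_def)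
  have M_prob: "prob_space (M j)" for j
    by (rule prob_spaceI) (simp add: M_def emeasure_restrict_space space_restrict_space)
  have M_int: "(LINT s|M j. g s) = (LINT s:{real j<..real j + 1}|lborel. g s)" for g :: "real \<Rightarrow> complex" and j
    by (simp add: M_def integral_restrict_space set_lebesgue_integral_def)
  have M_meas: "h \<in> borel_measurable (M j)" for j
    unfolding M_def by (intro measurable_restrict_space1) simp
  obtain s A where s: "\<And>j. s j \<in> space (M j)" and A: "0 \<le> A"
    and bound: "\<And>n m K. cmod (\<Sum>j<K. cis (real_of_int m / (real n + 1) * h (s j)) -
        (LINT x|M j. cis (real_of_int m / (real n + 1) * h x)))
      \<le> A * (sqrt (ln (real n + 2) * (ln (real n + 2) +
            ln (\<bar>real_of_int m\<bar> / (real n + 1) + 1)) / (real n + 1)) * real K +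
          (ln (real n + 2) + ln (\<bar>real_of_int m\<bar> / (real n + 1) + 1)) /
          sqrt (ln (real n + 2) * (ln (real n + 2) +
            ln (\<bar>real_of_int m\<bar> / (real n + 1) + 1)) / (real n + 1)))"
    by (rule cis_selection[of M h, OF M_prob M_meas]) (rule that)
  have s_bounds: "real j < s j" "s j \<le> real j + 1" for j
    using s[of j] by (auto simp: M_def space_restrict_space)
  have s_mono: "strict_mono s"
    by (rule strict_monoI) (smt (verit) s_bounds of_nat_less_iff of_nat_Suc Suc_leI of_nat_le_iff)
  have s_pos: "0 < s j" for j
    using s_bounds(1)[of j] of_nat_0_le_iff[of j] by linarith
  define p where "p j = quantile (s j)" for j
  have p_le: "p j \<le> x \<longleftrightarrow> s j \<le> F x" if "1 \<le> x" for j x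
    using that by (simp add: p_def quantile_le_iff)
  define K where "K x = nat \<lfloor>F x\<rfloor>" for x
  have K: "real (K x) \<le> F x" "F x < real (K x) + 1" if "1 \<le> x" for x
    using F_nonneg[OF that] unfolding K_def by linarith+
  \<comment> \<open>If j < K then s_j \<le> j + 1 \<le> K \<le> F(x); conversely j < s_j \<le> F(x)
    < K + 1 forces j \<le> K.\<close>
  have seg: "{..<K x} \<subseteq> {j. p j \<le> x}" "{j. p j \<le> x} \<subseteq> {..K x}" if "1 \<le> x" for x
  proof -
    show "{..<K x} \<subseteq> {j. p j \<le> x}"
    proof safe
      fix j assume "j < K x"
      then have "real j + 1 \<le> real (K x)" by linarith
      then show "p j \<le> x"
        using K[OF that] s_bounds[of j] unfolding p_le[OF that] by linarith
    qed
    show "{j. p j \<le> x} \<subseteq> {..K x}"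
    proof safe
      fix j assume "p j \<le> x"
      then have "real j < real (K x) + 1"
        using K[OF that] s_bounds[of j] unfolding p_le[OF that] by linarith
      then show "j \<le> K x" by linarith
    qed
  qed
  obtain C where C: "0 \<le> C" "\<And>x. 1 \<le> x \<Longrightarrow> F x * ln (x + 1) \<le> C * x"
    using chebyshev_bound[OF cheb] by metis
  show ?thesis
  proof (rule that)
    have "filterlim s at_top sequentially"
      by (rule filterlim_at_top_mono[OF filterlim_real_sequentially]) (use s_bounds(1) in \<open>auto intro!: always_eventually less_imp_le\<close>)
    then have "filterlim p at_top sequentially"
      unfolding p_def by (rule filterlim_compose[OF filterlim_quantile])
    moreover have "Fun.mono p"
      using s_mono mono_quantile by (auto simp: p_def mono_def strict_mono_less_eq)
    ultimately show "gen_primes p"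
      using quantile_gt_1[OF s_pos] by (simp add: gen_primes_def p_def)
    show "strict_mono p" if "continuous_on {1..} F"
      using quantile_strict_mono[OF that s_pos] s_mono by (auto simp: p_def strict_mono_def)
    show "\<bar>real (gpi p x) - F x\<bar> \<le> 1" if "1 \<le> x" for x
      using card_between[OF seg[OF that]] K[OF that] unfolding gpi_def by linarith
    fix t x :: real
    assume x: "1 \<le> x"
    \<comment> \<open>The test frequencies have denominator n + 1, so this choice makes the
      denominator the ceiling of x.\<close>
    define n where "n = nat \<lceil>x\<rceil> - 1"
    have n: "x \<le> real n + 1" "real n + 1 \<le> x + 1"
      using x unfolding n_def by linarith+
    \<comment> \<open>The target frequency is -t because u^(-it) = cis (-t ln u); rounding it to the
      grid costs at most 1 / (n + 1) \<le> 1 / x.\<close>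
    define m where "m = \<lfloor>- t * (real n + 1)\<rfloor>"
    define \<tau> where "\<tau> = real_of_int m / (real n + 1)"
    define B where "B = sqrt x + sqrt (x * ln (\<bar>t\<bar> + 1) / ln (x + 1))"
    have "\<bar>\<tau> + t\<bar> * (real n + 1) = \<bar>real_of_int m - (- t * (real n + 1))\<bar>"
      by (simp add: \<tau>_def abs_mult_pos[symmetric] field_simps del: abs_mult_pos)
    also have "\<dots> \<le> 1" unfolding m_def by linarith
    finally have "\<bar>\<tau> + t\<bar> \<le> 1 / (real n + 1)" by (simp add: field_simps)
    also have "\<dots> \<le> 1 / x" using n x by (intro divide_left_mono) auto
    finally have \<tau>: "\<bar>\<tau> + t\<bar> \<le> 1 / x" .
    have "1 / x \<le> 1" using x by simp
    then have "\<bar>\<tau>\<bar> \<le> \<bar>t\<bar> + 1" using \<tau> by linarith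
    moreover have "\<bar>\<tau>\<bar> = \<bar>real_of_int m\<bar> / (real n + 1)" by (simp add: \<tau>_def)
    ultimately have m: "\<bar>real_of_int m\<bar> / (real n + 1) \<le> \<bar>t\<bar> + 1" by simp
    have lx: "0 < ln (x + 1)" using x by simp
    have Kx: "real (K x) * ln (x + 1) \<le> C * x"
      using mult_right_mono[OF K(1)[OF x], of "ln (x + 1)"] C(2)[OF x] lx by linarith
    have main: "cmod (\<Sum>j<K x. cis (\<tau> * h (s j)) - (LINT u:{real j<..real j + 1}|lborel. cis (\<tau> * h u)))
        \<le> A * ((4 * C + 2) * B)"
      using order_trans[OF bound mult_left_mono[OF optimised_bound_le[OF x n m Kx C(1)] A]]
      by (simp add: \<tau>_def B_def M_int)
    \<comment> \<open>Up to height F(x) the phase h is at most ln x, so the rounding error 1 / x in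
      the frequency moves each value by at most ln x / x.\<close>
    have diff: "cmod (cis (- t * h u) - cis (\<tau> * h u)) \<le> ln x / x" if "u \<le> F x" for u
    proof -
      have "cmod (cis (- t * h u) - cis (\<tau> * h u)) \<le> \<bar>(- t * h u) - \<tau> * h u\<bar>"
        by (rule norm_cis_diff_le)
      also have "(- t * h u) - \<tau> * h u = - ((\<tau> + t) * h u)" by (simp add: algebra_simps)
      also have "\<bar>- ((\<tau> + t) * h u)\<bar> = \<bar>\<tau> + t\<bar> * h u"
        using h_nonneg[of u] by (simp add: abs_mult)
      also have "\<dots> \<le> 1 / x * ln x"
      proof (rule mult_mono[OF \<tau>])
        have "quantile u \<le> x" using that x by (simp add: quantile_le_iff)
        then show "h u \<le> ln x"
          unfolding h_def using quantile_ge_1[of u] by (subst ln_le_cancel_iff) auto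
      qed (use h_nonneg x in auto)
      finally show ?thesis by simp
    qed
    have cis_meas: "(\<lambda>u. cis (c * h u)) \<in> borel_measurable borel" for c
      unfolding cis_conv_exp by measurable
    have int: "set_integrable lborel {a<..b} (\<lambda>u. cis (c * h u))" for a b c
      by (rule set_integrable_bounded_Ioc[where c = 1]) (simp_all add: cis_meas)
    \<comment> \<open>The centred j-th term at frequency c: selection controls its sum at \<tau>,
      the theorem asks for it at -t.\<close>
    define e where "e c j = cis (c * h (s j)) - (LINT u:{real j<..real j + 1}|lborel. cis (c * h u))" for c j
    have e_diff: "cmod (e (- t) j - e \<tau> j) \<le> 2 * (ln x / x)" if "j < K x" for j
    proof -
      have j: "real j + 1 \<le> F x" using that K(1)[OF x] by linarith
      have "e (- t) j - e \<tau> j = (cis (- t * h (s j)) - cis (\<tau> * h (s j))) -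
          (LINT u:{real j<..real j + 1}|lborel. cis (- t * h u) - cis (\<tau> * h u))"
        unfolding e_def by (subst set_integral_diff(2)[OF int int]) simp
      also have "cmod \<dots> \<le> ln x / x + ln x / x * (real j + 1 - real j)"
      proof (rule order_trans[OF norm_triangle_ineq4 add_mono])
        show "cmod (LINT u:{real j<..real j + 1}|lborel. cis (- t * h u) - cis (\<tau> * h u))
            \<le> ln x / x * (real j + 1 - real j)"
          using j diff by (intro norm_set_integral_Ioc_le borel_measurable_diff cis_meas) auto
      qed (use j s_bounds[of j] diff in auto)
      finally show ?thesis by simp
    qed
    have "cmod ((\<Sum>j<K x. e (- t) j) - (\<Sum>j<K x. e \<tau> j)) \<le> (\<Sum>j<K x. 2 * (ln x / x))"
      unfolding sum_subtractf[symmetric] by (rule sum_norm_le) (use e_diff in simp)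
    also have "\<dots> = 2 * (real (K x) * ln x / x)" by simp
    \<comment> \<open>The Chebyshev bound on the number of terms is what makes a grid of spacing
      about 1 / x fine enough.\<close>
    also have "\<dots> \<le> 2 * C"
    proof -
      have "real (K x) * ln x \<le> real (K x) * ln (x + 1)"
        using x by (intro mult_left_mono) auto
      also note Kx
      finally show ?thesis using x by (simp add: field_simps)
    qed
    finally have grid: "cmod ((\<Sum>j<K x. e (- t) j) - (\<Sum>j<K x. e \<tau> j)) \<le> 2 * C" .
    define Z where "Z = (\<Sum>j\<in>{j. p j \<le> x}. (complex_of_real (p j)) powr (- (\<i> * complex_of_real t)))"
    have "Z = (\<Sum>j\<in>{j. p j \<le> x}. cis (- t * h (s j)))"
      unfolding Z_def p_def h_def
      by (intro sum.cong refl powr_minus_ii_eq_cis) (use quantile_gt_1[OF s_pos] in \<open>auto intro: less_trans[of 0 1]\<close>)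
    then have Z: "cmod (Z - (\<Sum>j<K x. cis (- t * h (s j)))) \<le> 1"
      using sum_cis_initial_segment[OF seg[OF x]] by simp
    \<comment> \<open>The part of the integral beyond the last complete unit interval; its length is
      below 1.\<close>
    define R where "R = (LINT u:{real (K x)<..F x}|lborel. cis (- t * h u))"
    have "cmod R \<le> 1 * (F x - real (K x))"
      unfolding R_def by (rule norm_set_integral_Ioc_le) (use cis_meas[of "- t"] K[OF x] in auto)
    then have R: "cmod R \<le> 1" using K[OF x] by simp
    have I: "stieltjes_int F (\<lambda>u. (complex_of_real u) powr (- (\<i> * complex_of_real t))) x =
        (\<Sum>j<K x. LINT u:{real j<..real j + 1}|lborel. cis (- t * h u)) + R"
      unfolding stieltjes_int_powr[OF x] h_def[symmetric] R_def
      by (rule set_integral_Ioc_split[where c = 1]) (use cis_meas[of "- t"] K[OF x] in auto)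
    \<comment> \<open>Lets the bounded errors be absorbed into a multiple of
      \<open>B\<close>.\<close>
    have "1 \<le> B"
      using x lx unfolding B_def by (intro add_increasing2) auto
    \<comment> \<open>Four errors: the undecided index K, the rounding of the frequency, the
      selection bound, and the incomplete interval.\<close>
    have "Z - stieltjes_int F (\<lambda>u. (complex_of_real u) powr (- (\<i> * complex_of_real t))) x =
        (Z - (\<Sum>j<K x. cis (- t * h (s j)))) + ((\<Sum>j<K x. e (- t) j) - (\<Sum>j<K x. e \<tau> j))
          + (\<Sum>j<K x. e \<tau> j) - R"
      unfolding I by (simp add: e_def sum_subtractf)
    also have "cmod \<dots> \<le> 1 + 2 * C + A * ((4 * C + 2) * B) + 1"
      by (rule order_trans[OF norm_triangle_ineq4 add_mono[OF order_trans[OF norm_triangle_ineq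
              add_mono[OF order_trans[OF norm_triangle_ineq add_mono]]]]])
         (fact Z, fact grid, use main in \<open>simp add: e_def\<close>, fact R)
    also have "\<dots> \<le> (A * (4 * C + 2) + 2 * C + 2) * B"
      using mult_left_mono[OF \<open>1 \<le> B\<close>, of "2 * C + 2"] C(1) by (simp add: algebra_simps)
    finally show "cmod ((\<Sum>j\<in>{j. p j \<le> x}. (complex_of_real (p j)) powr (- (\<i> * complex_of_real t)))
        - stieltjes_int F (\<lambda>u. (complex_of_real u) powr (- (\<i> * complex_of_real t))) x)
      \<le> (A * (4 * C + 2) + 2 * C + 2) * (sqrt x + sqrt (x * ln (\<bar>t\<bar> + 1) / ln (x + 1)))"
      unfolding Z_def B_def .
  qed
qed

end

theorem theorem1p2:
  fixes F :: "real \<Rightarrow> real"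
  assumes mono: "mono_on {1..} F"
    and rcont: "\<And>x. x \<ge> 1 \<Longrightarrow> continuous (at_right x) F"
    and F1: "F 1 = 0"
    and Finf: "filterlim F at_top at_top"
    and cheb: "F \<in> O(\<lambda>x. x / ln x)"
  shows "(\<exists>p. gen_primes p
           \<and> (\<forall>x\<ge>1. \<bar>real (gpi p x) - F x\<bar> \<le> 2)
           \<and> (\<exists>C. \<forall>t x. x \<ge> 1 \<longrightarrow>
                 norm ((\<Sum>j\<in>{j. p j \<le> x}. (complex_of_real (p j)) powr (- (\<i> * complex_of_real t)))
                       - stieltjes_int F (\<lambda>u. (complex_of_real u) powr (- (\<i> * complex_of_real t))) x)
                 \<le> C * (sqrt x + sqrt (x * ln (\<bar>t\<bar> + 1) / ln (x + 1)))))
       \<and> (continuous_on {1..} F \<longrightarrow>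
          (\<exists>p. gen_primes p \<and> strict_mono p
           \<and> (\<forall>x\<ge>1. \<bar>real (gpi p x) - F x\<bar> \<le> 1)
           \<and> (\<exists>C. \<forall>t x. x \<ge> 1 \<longrightarrow>
                 norm ((\<Sum>j\<in>{j. p j \<le> x}. (complex_of_real (p j)) powr (- (\<i> * complex_of_real t)))
                       - stieltjes_int F (\<lambda>u. (complex_of_real u) powr (- (\<i> * complex_of_real t))) x)
                 \<le> C * (sqrt x + sqrt (x * ln (\<bar>t\<bar> + 1) / ln (x + 1))))))"
proof -
  interpret unbounded_rcont_mono F
    by unfold_locales (fact mono, fact rcont, fact F1, fact Finf)
  \<comment> \<open>One sequence serves both halves: the counting error is at most 1 in either case,
    and continuity only adds strict monotonicity.\<close>
  obtain p C where p: "gen_primes p" "\<And>x. 1 \<le> x \<Longrightarrow> \<bar>real (gpi p x) - F x\<bar> \<le> 1"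
    "continuous_on {1..} F \<Longrightarrow> strict_mono p"
    "\<And>t x. 1 \<le> x \<Longrightarrow>
      norm ((\<Sum>j\<in>{j. p j \<le> x}. (complex_of_real (p j)) powr (- (\<i> * complex_of_real t)))
        - stieltjes_int F (\<lambda>u. (complex_of_real u) powr (- (\<i> * complex_of_real t))) x)
      \<le> C * (sqrt x + sqrt (x * ln (\<bar>t\<bar> + 1) / ln (x + 1)))"
    using generalized_primes_exist[OF cheb] by blast
  have "\<bar>real (gpi p x) - F x\<bar> \<le> 2" if "1 \<le> x" for x
    using p(2)[OF that] by simp
  with p show ?thesis
    by blast
qed

end
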